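(* Let $n$ be a non-negative integer. Let $q,x,c$ be complex numbers for which $q,x\neq 0$ and no denominator occurring below vanishes (equivalently, the identity is one of rational functions in indeterminates $q,x,c$). Then $$ \left(\sum_{k=0}^{n} \frac{(q^{-n};q)_k (x;q^2)_k\, q^k }{(q;q)_{k} (c;q)_{k}}\right) \left(\sum_{k=0}^{n} \frac{(q^{-n};q)_k (x;q^2)_k\, c^k q^{nk-\binom{k}{2}} }{(q;q)_{k} (c;q)_{k}\, x^k }\right) =\sum_{k=0}^{n} \frac{(q^{-n};q)_k (cq^{n};q)_k (x;q^2)_k (c^2/x;q^2)_k\, q^{k}}{(q;q)_{k}(c;q)_{k} (c;q)_{2k}}. $$
   Context: For any base $p$, the shifted factorial is $(a;p)_0=1$ and $(a;p)_k=(1-a)(1-ap)\cdots(1-ap^{k-1})$ for $k\geq 1$ (used here with $p=q$ and $p=q^2$). *)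

theory Defs
  imports Complex_Main
begin

definition qpoch :: "complex \<Rightarrow> complex \<Rightarrow> nat \<Rightarrow> complex" where
  "qpoch a p k = (\<Prod>i<k. 1 - a * p ^ i)"

end

theory Submission
  imports Defs
begin

text \<open>
  Write \<open>A\<^sub>n\<close> and \<open>B\<^sub>n\<close> for the two sums on the left (\<open>factorA\<close>, \<open>factorB\<close>). Each satisfies a
  three-term recurrence in \<open>n\<close>; with \<open>Q = q^(n+1)\<close>,
  \<open>(1 - c Q) A\<^sub>n\<^sub>+\<^sub>2 = (x - c) Q A\<^sub>n\<^sub>+\<^sub>1 + x (1 - Q) A\<^sub>n\<close> and
  \<open>(1 - c Q) B\<^sub>n\<^sub>+\<^sub>2 = (1 - c/x) B\<^sub>n\<^sub>+\<^sub>1 + (c/x) (1 - Q) B\<^sub>n\<close>.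
  The second is the first under \<open>q, x, c \<mapsto> 1/q, 1/x, 1/c\<close>, a substitution that exchanges the two sums.

  Multiplying the recurrences shows that the product \<open>u\<^sub>n = A\<^sub>n B\<^sub>n\<close> does not close up by itself, but
  together with the mixed products \<open>v\<^sub>n = (x - c) A\<^sub>n\<^sub>-\<^sub>1 B\<^sub>n\<close> and \<open>w\<^sub>n = (1 - c/x) A\<^sub>n B\<^sub>n\<^sub>-\<^sub>1\<close> it does. The
  resulting system has coefficients that depend on \<open>x\<close> only through \<open>Z = (x - c) (1 - c/x)\<close>, so that
  \<open>u\<close>, \<open>v\<close> and \<open>w\<close> are polynomials in \<open>Z\<close>. The right-hand side of the identity is an expansion in
  the basis \<open>\<phi>\<^sub>k = (x;q\<^sup>2)\<^sub>k (c\<^sup>2/x;q\<^sup>2)\<^sub>k\<close> of such polynomials: since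
  \<open>(1 - x p) (1 - c\<^sup>2 p/x) = (1 - c p)\<^sup>2 - p Z\<close>, multiplication by \<open>Z\<close> sends \<open>\<phi>\<^sub>k\<close> to a combination of
  \<open>\<phi>\<^sub>k\<close> and \<open>\<phi>\<^sub>k\<^sub>+\<^sub>1\<close>.

  The decisive point is that \<open>v\<close> and \<open>w\<close> also have closed-form coefficients in this basis
  (\<open>coeffV\<close>, \<open>coeffW\<close>), namely those of the right-hand side times a rational function of \<open>q\<close>, \<open>q^n\<close>,
  \<open>q^k\<close> and \<open>c\<close>. Comparing coefficients of \<open>\<phi>\<^sub>k\<close>, the whole system becomes three rational identities
  (\<open>coeffU_rec\<close>, \<open>coeffV_rec\<close>, \<open>coeffW_rec\<close>), and induction on \<open>n\<close> gives the theorem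
  (\<open>products_eq_phi_sums\<close>). The recurrences for \<open>A\<close> and \<open>B\<close> are obtained by the same coefficient
  comparison, in the bases \<open>(x;q\<^sup>2)\<^sub>k\<close> and \<open>(x;q\<^sup>2)\<^sub>k / x^k\<close>.
\<close>

section \<open>Shifted factorials\<close>

lemma qpoch_0 [simp]: "qpoch a p 0 = 1" by (simp add: qpoch_def)

lemma qpoch_Suc: "qpoch a p (Suc k) = qpoch a p k * (1 - a * p ^ k)" by (simp add: qpoch_def)

lemma qpoch_Suc_left: "qpoch a p (Suc k) = (1 - a) * qpoch (a * p) p k"
  unfolding qpoch_def by (subst prod.lessThan_Suc_shift) (simp add: mult.assoc)

lemma qpoch_shift: "(1 - a) * qpoch (a * p) p k = qpoch a p k * (1 - a * p ^ k)"
  using qpoch_Suc qpoch_Suc_left by metis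

lemma qpoch_shift_div: "a \<noteq> 1 \<Longrightarrow> qpoch (a * p) p k = qpoch a p k * (1 - a * p ^ k) / (1 - a)"
  using qpoch_shift[of a p k] by (simp add: field_simps)

lemma small_choose_two [simp]: "0 choose 2 = 0" "Suc 0 choose 2 = 0"
  by (simp_all add: numeral_2_eq_2)

section \<open>Coefficients of the five expansions\<close>

text \<open>
  The parameter \<open>Q\<close> stands for \<open>q^n\<close>. Keeping it free of \<open>n\<close> turns the shifts \<open>n \<plusminus> 1\<close> into \<open>Q * q\<close> and
  \<open>Q / q\<close>, and every recurrence below into an identity of rational functions of \<open>q, Q, c, q^k\<close>.
\<close>

definition coeffA :: "complex \<Rightarrow> complex \<Rightarrow> complex \<Rightarrow> nat \<Rightarrow> complex" where
  "coeffA q c Q k = qpoch (1/Q) q k * q^k / (qpoch q q k * qpoch c q k)"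

definition coeffB :: "complex \<Rightarrow> complex \<Rightarrow> complex \<Rightarrow> nat \<Rightarrow> complex" where
  "coeffB q c Q k = qpoch (1/Q) q k * (c*Q)^k / (q^(k choose 2) * (qpoch q q k * qpoch c q k))"

definition coeffU :: "complex \<Rightarrow> complex \<Rightarrow> complex \<Rightarrow> nat \<Rightarrow> complex" where
  "coeffU q c Q k = qpoch (1/Q) q k * qpoch (c*Q) q k * q^k / (qpoch q q k * qpoch c q k * qpoch c q (2*k))"

text \<open>
  The coefficients of the mixed products \<open>(x - c) A\<^sub>n\<^sub>-\<^sub>1 B\<^sub>n\<close> and \<open>(1 - c/x) A\<^sub>n B\<^sub>n\<^sub>-\<^sub>1\<close>. Their ratio to \<open>coeffU\<close>
  is the solution of the linear equations that the recurrences impose, decomposed into partial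
  fractions in \<open>Q\<close>. In this form the factor \<open>1 - q^k\<close> shows that both coefficients are \<open>1 - c\<close> at
  \<open>k = 0\<close>, as they must be: at \<open>x = 1\<close> only \<open>\<phi>\<^sub>0\<close> survives and all factors \<open>A\<close>, \<open>B\<close> are \<open>1\<close>.
\<close>

definition coeffV :: "complex \<Rightarrow> complex \<Rightarrow> complex \<Rightarrow> nat \<Rightarrow> complex" where
  "coeffV q c Q k = coeffU q c Q k / (q^k)^2 * (1 - c*(q^k)^2 + (1 - q^k) * ((q-1)/(1-Q) - q*(q - c*(q^k)^2)/(q - c*Q*q^k)))"

definition coeffW :: "complex \<Rightarrow> complex \<Rightarrow> complex \<Rightarrow> nat \<Rightarrow> complex" where
  "coeffW q c Q k = coeffU q c Q k / q^k * (1 - c*(q^k)^2 + (1 - q^k) * (c*(q^k)^2*(q-1)/(q*(1-Q)) - (q - c*(q^k)^2)/(q - c*Q*q^k)))"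

text \<open>
  For \<open>Q = q^n\<close>, this expresses the numerators \<open>(q^(-m);q)\<^sub>k\<close> with \<open>m = n - 1, n, n + 1\<close> and \<open>k = j, j + 1\<close>
  that meet in a recurrence through the single one with \<open>m = n\<close>, \<open>k = j\<close>. Taking this one as the
  reference leaves only denominators such as \<open>1 - 1/Q\<close>, never \<open>(q^(-n);q)\<^sub>k\<close> itself, which may vanish.
\<close>

lemma qpoch_inverse_levels:
  fixes q Q :: complex and j :: nat
  assumes "q \<noteq> 0" "Q \<noteq> 0" "Q \<noteq> 1"
  defines "g \<equiv> qpoch (1/Q) q j"
  shows "qpoch (1/Q) q (Suc j) = g * (1 - q^j/Q)"
    "qpoch (1/(Q*q)) q (Suc j) = (1 - 1/(Q*q)) * g"
    "qpoch (1/(Q/q)) q j = g * (1 - q^j/Q) / (1 - 1/Q)"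
    "qpoch (1/(Q/q)) q (Suc j) = g * (1 - q^j/Q) / (1 - 1/Q) * (1 - q*q^j/Q)"
proof -
  show 3: "qpoch (1/(Q/q)) q j = g * (1 - q^j/Q) / (1 - 1/Q)"
    using qpoch_shift_div[of "1/Q" q j] assms by (simp add: g_def)
  show "qpoch (1/Q) q (Suc j) = g * (1 - q^j/Q)" by (simp add: qpoch_Suc g_def)
  show "qpoch (1/(Q*q)) q (Suc j) = (1 - 1/(Q*q)) * g" using assms by (simp add: qpoch_Suc_left g_def)
  show "qpoch (1/(Q/q)) q (Suc j) = g * (1 - q^j/Q) / (1 - 1/Q) * (1 - q*q^j/Q)" using 3 by (simp add: qpoch_Suc)
qed

text \<open>
  The coefficient form of the recurrence for \<open>A\<^sub>n\<close>. Since
  \<open>x (x;q\<^sup>2)\<^sub>k = q^(-2k) ((x;q\<^sup>2)\<^sub>k - (x;q\<^sup>2)\<^sub>k\<^sub>+\<^sub>1)\<close>, the coefficient of \<open>(x;q\<^sup>2)\<^sub>j\<^sub>+\<^sub>1\<close> in \<open>x A\<^sub>n\<close> collects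
  contributions from \<open>j + 1\<close> and \<open>j\<close>. All terms are rational multiples of the term \<open>X\<close> at \<open>Q\<close> and \<open>j\<close>.
\<close>

lemma coeffA_rec:
  assumes "q \<noteq> 0" "Q \<noteq> 0" "Q \<noteq> 1" "q * q^j \<noteq> 1" "c * q^j \<noteq> 1"
  shows "(1 - c*Q) * coeffA q c (Q*q) (Suc j) =
    Q * ((1/(q^Suc j)^2 - c) * coeffA q c Q (Suc j) - coeffA q c Q j / (q^j)^2)
    + (1-Q) * (coeffA q c (Q/q) (Suc j) / (q^Suc j)^2 - coeffA q c (Q/q) j / (q^j)^2)"
proof -
  define X where "X = qpoch (1/Q) q j * q^j / (qpoch q q j * qpoch c q j)"
  define J where "J = q^j"
  have nz: "J \<noteq> 0" "1 - q*J \<noteq> 0" "1 - c*J \<noteq> 0" "1 - Q \<noteq> 0" using assms by (auto simp: J_def)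
  note s = qpoch_inverse_levels[OF assms(1-3), of j, folded J_def]
  have u: "qpoch q q (Suc j) = qpoch q q j * (1-q*J)" "qpoch c q (Suc j) = qpoch c q j * (1-c*J)"
    "q^Suc j = q*J"
    by (simp_all add: qpoch_Suc J_def)
  have 1: "coeffA q c Q j = X" by (simp add: coeffA_def X_def)
  have 2: "coeffA q c Q (Suc j) = X * ((1-J/Q) * q/((1-q*J)*(1-c*J)))" 
    unfolding coeffA_def s u X_def by (simp add: J_def mult_ac)
  have 3: "coeffA q c (Q*q) (Suc j) = X * ((1-1/(Q*q)) * q/((1-q*J)*(1-c*J)))" 
    unfolding coeffA_def s u X_def by (simp add: J_def mult_ac)
  have 4: "coeffA q c (Q/q) j = X * ((1-J/Q)/(1-1/Q))" 
    unfolding coeffA_def s u X_def by (simp add: J_def mult_ac)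
  have 5: "coeffA q c (Q/q) (Suc j) = X * ((1-J/Q)/(1-1/Q)*(1-q*J/Q) * q/((1-q*J)*(1-c*J)))" 
    unfolding coeffA_def s u X_def by (simp add: J_def mult_ac)
  show ?thesis unfolding 1 2 3 4 5 J_def[symmetric] u(3) using nz assms(1,2)
    by (simp add: divide_simps) (simp add: algebra_simps power2_eq_square)
qed

text \<open>
  The same for \<open>B\<^sub>n\<close> and the basis \<open>\<chi>\<^sub>k = (x;q\<^sup>2)\<^sub>k / x^k\<close>, where \<open>\<chi>\<^sub>k / x = q^(2k) \<chi>\<^sub>k + \<chi>\<^sub>k\<^sub>+\<^sub>1\<close>. Here the
  power \<open>(c Q)^k\<close> also changes with the level, so the common factor \<open>X\<close> carries \<open>(c Q/q)^j\<close>.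
\<close>

lemma coeffB_rec:
  assumes "q \<noteq> 0" "Q \<noteq> 0" "Q \<noteq> 1" "q * q^j \<noteq> 1" "c * q^j \<noteq> 1"
  shows "(1 - c*Q) * coeffB q c (Q*q) (Suc j) =
    coeffB q c Q (Suc j) - c * ((q^Suc j)^2 * coeffB q c Q (Suc j) + coeffB q c Q j)
    + c*(1-Q) * ((q^Suc j)^2 * coeffB q c (Q/q) (Suc j) + coeffB q c (Q/q) j)"
proof -
  define J where "J = q^j"
  have ch: "Suc j choose 2 = (j choose 2) + j" by (simp add: numeral_2_eq_2)
  have qc: "q ^ (Suc j choose 2) = q^(j choose 2) * J" by (simp add: ch power_add J_def)
  define X where "X = qpoch (1/Q) q j * (c*(Q/q))^j / (q^(j choose 2) * (qpoch q q j * qpoch c q j))"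
  have nz: "J \<noteq> 0" "1 - q*J \<noteq> 0" "1 - c*J \<noteq> 0" "1 - Q \<noteq> 0" using assms by (auto simp: J_def)
  note s = qpoch_inverse_levels[OF assms(1-3), of j, folded J_def]
  have u: "qpoch q q (Suc j) = qpoch q q j * (1-q*J)" "qpoch c q (Suc j) = qpoch c q j * (1-c*J)"
    "q^Suc j = q*J"
    by (simp_all add: qpoch_Suc J_def)
  have v: "(c*Q)^j = (c*(Q/q))^j * J" "(c*(Q*q))^j = (c*(Q/q))^j * J^2" 
     "(c*Q)^Suc j = (c*(Q/q))^j * J * (c * Q)" "(c*(Q*q))^Suc j = (c*(Q/q))^j * J^2 * (c*Q*q)"
     "(c*(Q/q))^Suc j = (c*(Q/q))^j * (c*(Q/q))"
    using assms(1) by (simp_all add: J_def power_mult_distrib power_divide power2_eq_square mult_ac)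
  have 1: "coeffB q c Q j = X * J" unfolding coeffB_def X_def v by simp
  have 2: "coeffB q c Q (Suc j) = X * ((1-J/Q) * c*Q/((1-q*J)*(1-c*J)))" 
    unfolding coeffB_def s u X_def qc v using nz by (simp add: mult_ac)
  have 3: "coeffB q c (Q*q) (Suc j) = X * ((1-1/(Q*q)) * c*Q*q*J/((1-q*J)*(1-c*J)))" 
    unfolding coeffB_def s u X_def qc v using nz by (simp add: power2_eq_square mult_ac)
  have 4: "coeffB q c (Q/q) j = X * ((1-J/Q)/(1-1/Q))" 
    unfolding coeffB_def s u X_def by (simp add: mult_ac)
  have 5: "coeffB q c (Q/q) (Suc j) = X * ((1-J/Q)/(1-1/Q)*(1-q*J/Q) * (c*(Q/q))/(J*((1-q*J)*(1-c*J))))" 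
    unfolding coeffB_def s u X_def qc v by (simp add: mult_ac)
  show ?thesis unfolding 1 2 3 4 5 J_def[symmetric] u(3) using nz assms(1,2)
    by (simp add: divide_simps) (simp add: algebra_simps power2_eq_square)
qed

lemma qpoch_mult_levels:
  fixes q Q c :: complex and j :: nat
  assumes "q \<noteq> 0" "c * Q \<noteq> 1"
  defines "g \<equiv> qpoch (c*Q) q j"
  shows "qpoch (c*Q) q (Suc j) = g * (1 - c*Q*q^j)"
    "qpoch (c*(Q/q)) q (Suc j) = (1 - c*(Q/q)) * g"
    "qpoch (c*(Q*q)) q (Suc j) = g * (1 - c*Q*q^j) / (1 - c*Q) * (1 - c*Q*q*q^j)"
proof -
  have 3: "qpoch (c*(Q*q)) q j = g * (1 - c*Q*q^j) / (1 - c*Q)"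
    using qpoch_shift_div[of "c*Q" q j] assms by (simp add: g_def mult.assoc)
  show "qpoch (c*Q) q (Suc j) = g * (1 - c*Q*q^j)" by (simp add: qpoch_Suc g_def mult.assoc)
  show "qpoch (c*(Q/q)) q (Suc j) = (1 - c*(Q/q)) * g" using assms by (simp add: qpoch_Suc_left g_def mult.assoc)
  show "qpoch (c*(Q*q)) q (Suc j) = g * (1 - c*Q*q^j) / (1 - c*Q) * (1 - c*Q*q*q^j)" 
   using 3 by (simp add: qpoch_Suc mult.assoc)
qed

lemma qpoch_double_Suc: "qpoch c q (2 * Suc j) = qpoch c q (2*j) * ((1 - c*(q^j)^2) * (1 - c*q*(q^j)^2))"
proof -
  have "2 * Suc j = Suc (Suc (2*j))" by simp
  then show ?thesis by (simp only: qpoch_Suc) (simp add: power_mult power_even_eq mult_ac)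
qed

text \<open>
  The three other terms of a recurrence as rational multiples of the one at \<open>Q\<close> and \<open>j\<close>, so that it
  factors out of the recurrence; \<open>D\<close> is the quotient of the denominators at \<open>j + 1\<close> and \<open>j\<close>.
\<close>

lemma coeffU_neighbours:
  fixes q c Q :: complex and j :: nat
  assumes "q \<noteq> 0" "Q \<noteq> 0" "Q \<noteq> 1" "c * Q \<noteq> 1"
  defines "J \<equiv> q^j" 
  defines "D \<equiv> (1-q*J)*(1-c*J)*((1 - c*J^2) * (1 - c*q*J^2))"
  shows "coeffU q c Q (Suc j) = coeffU q c Q j * ((1-J/Q) * (1-c*Q*J)* q/D)"
   "coeffU q c (Q*q) (Suc j) = coeffU q c Q j * ((1-1/(Q*q)) * ((1-c*Q*J)/(1-c*Q)*(1-c*Q*q*J))* q/D)"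
   "coeffU q c (Q/q) (Suc j) = coeffU q c Q j * ((1-J/Q) / (1-1/Q) * (1-q*J/Q) * (1-c*(Q/q)) * q/D)"
proof -
  note s = qpoch_inverse_levels[OF assms(1-3), of j, folded J_def]
  note t = qpoch_mult_levels[OF assms(1,4), of j, folded J_def]
  have u: "qpoch q q (Suc j) = qpoch q q j * (1-q*J)" "qpoch c q (Suc j) = qpoch c q j * (1-c*J)" "q^Suc j = q^j*q"
    by (simp_all add: qpoch_Suc J_def)
  note v = qpoch_double_Suc[of c q j, folded J_def]
  show "coeffU q c Q (Suc j) = coeffU q c Q j * ((1-J/Q) * (1-c*Q*J)* q/D)"
    unfolding coeffU_def s t u v D_def by (simp add: mult_ac)
  show "coeffU q c (Q*q) (Suc j) = coeffU q c Q j * ((1-1/(Q*q)) * ((1-c*Q*J)/(1-c*Q)*(1-c*Q*q*J))* q/D)"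
    unfolding coeffU_def s t u v D_def by (simp add: mult_ac)
  show "coeffU q c (Q/q) (Suc j) = coeffU q c Q j * ((1-J/Q) / (1-1/Q) * (1-q*J/Q) * (1-c*(Q/q)) * q/D)"
    unfolding coeffU_def s t u v D_def by (simp add: mult_ac)
qed

text \<open>
  This and the next two lemmas are the system of recurrences for \<open>u, v, w\<close>, read off at \<open>\<phi>\<^sub>j\<^sub>+\<^sub>1\<close>. The
  two terms with \<open>coeffU q c Q\<close> at \<open>Suc j\<close> and \<open>j\<close> form the coefficient of \<open>Z u\<close>.
\<close>

lemma coeffV_rec:
  assumes "q \<noteq> 0" "Q \<noteq> 0" "Q \<noteq> 1" "Q*q \<noteq> 1" "c*Q \<noteq> 1" "q * q^j \<noteq> 1" "c * q^j \<noteq> 1"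
     "c*(q^j)^2 \<noteq> 1" "c*q*(q^j)^2 \<noteq> 1" "c * Q * q^j \<noteq> 1" "c * Q * q * q^j \<noteq> 1"
  shows "(1 - c*Q) * coeffV q c (Q*q) (Suc j) =
    (1-c*(q^Suc j)^2)^2 / (q^Suc j)^2 * coeffU q c Q (Suc j) - coeffU q c Q j / (q^j)^2 
    + c*(1-Q) * coeffW q c Q (Suc j)"
proof -
  define J where "J = q^j"
  define X where "X = coeffU q c Q j"
  have nz: "J \<noteq> 0" "1 - q*J \<noteq> 0" "1 - c*J \<noteq> 0" "1 - Q \<noteq> 0" "1 - Q * q \<noteq> 0" "1 - c*Q \<noteq> 0" "1 - c * J^2 \<noteq> 0"
    "1 - c * q * J^2 \<noteq> 0" "1 - c*Q*J \<noteq> 0" "1 - c*Q*q*J \<noteq> 0" using assms by (auto simp: J_def)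
  have f: "q - c*Q*(q*J) = q*(1-c*Q*J)" "q - c*(Q*q)*(q*J) = q*(1-c*Q*q*J)" by (simp_all add: algebra_simps)
  have e: "q^Suc j = q*J" by (simp add: J_def)
  show ?thesis unfolding coeffV_def coeffW_def coeffU_neighbours[OF assms(1-3,5)] X_def[symmetric] unfolding e J_def[symmetric] f
    using nz assms(1,2)
    by (simp add: divide_simps) (simp add: algebra_simps power2_eq_square power3_eq_cube)
qed

lemma coeffW_rec:
  assumes "q \<noteq> 0" "Q \<noteq> 0" "Q \<noteq> 1" "Q*q \<noteq> 1" "c*Q \<noteq> 1" "q * q^j \<noteq> 1" "c * q^j \<noteq> 1"
     "c*(q^j)^2 \<noteq> 1" "c*q*(q^j)^2 \<noteq> 1" "c * Q * q^j \<noteq> 1" "c * Q * q * q^j \<noteq> 1"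
  shows "(1 - c*Q) * coeffW q c (Q*q) (Suc j) =
    Q * ((1-c*(q^Suc j)^2)^2 / (q^Suc j)^2 * coeffU q c Q (Suc j) - coeffU q c Q j / (q^j)^2) 
    + (1-Q) * coeffV q c Q (Suc j)"
proof -
  define J where "J = q^j"
  define X where "X = coeffU q c Q j"
  have nz: "J \<noteq> 0" "1 - q*J \<noteq> 0" "1 - c*J \<noteq> 0" "1 - Q \<noteq> 0" "1 - Q * q \<noteq> 0" "1 - c*Q \<noteq> 0" "1 - c * J^2 \<noteq> 0"
    "1 - c * q * J^2 \<noteq> 0" "1 - c*Q*J \<noteq> 0" "1 - c*Q*q*J \<noteq> 0" using assms by (auto simp: J_def)
  have f: "q - c*Q*(q*J) = q*(1-c*Q*J)" "q - c*(Q*q)*(q*J) = q*(1-c*Q*q*J)" by (simp_all add: algebra_simps)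
  have e: "q^Suc j = q*J" by (simp add: J_def)
  show ?thesis unfolding coeffV_def coeffW_def coeffU_neighbours[OF assms(1-3,5)] X_def[symmetric] unfolding e J_def[symmetric] f
    using nz assms(1,2)
    by (simp add: divide_simps) (simp add: algebra_simps power2_eq_square power3_eq_cube)
qed

lemma coeffU_rec:
  assumes "q \<noteq> 0" "Q \<noteq> 0" "Q \<noteq> 1" "Q*q \<noteq> 1" "c*Q \<noteq> 1" "q * q^j \<noteq> 1" "c * q^j \<noteq> 1"
     "c*(q^j)^2 \<noteq> 1" "c*q*(q^j)^2 \<noteq> 1" "c * Q * q^j \<noteq> 1" "c * Q * q * q^j \<noteq> 1"
  shows "(1 - c*Q)^2 * coeffU q c (Q*q) (Suc j) =
    Q * ((1-c*(q^Suc j)^2)^2 / (q^Suc j)^2 * coeffU q c Q (Suc j) - coeffU q c Q j / (q^j)^2) 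
    + c*(1-Q)*Q * coeffW q c Q (Suc j) + (1-Q) * coeffV q c Q (Suc j) + c*(1-Q)^2 * coeffU q c (Q/q) (Suc j)"
proof -
  define J where "J = q^j"
  define X where "X = coeffU q c Q j"
  have nz: "J \<noteq> 0" "1 - q*J \<noteq> 0" "1 - c*J \<noteq> 0" "1 - Q \<noteq> 0" "1 - Q * q \<noteq> 0" "1 - c*Q \<noteq> 0" "1 - c * J^2 \<noteq> 0"
    "1 - c * q * J^2 \<noteq> 0" "1 - c*Q*J \<noteq> 0" "1 - c*Q*q*J \<noteq> 0" using assms by (auto simp: J_def)
  have f: "q - c*Q*(q*J) = q*(1-c*Q*J)" "q - c*(Q*q)*(q*J) = q*(1-c*Q*q*J)" by (simp_all add: algebra_simps)
  have e: "q^Suc j = q*J" by (simp add: J_def)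
  show ?thesis unfolding coeffV_def coeffW_def coeffU_neighbours[OF assms(1-3,5)] X_def[symmetric] unfolding e J_def[symmetric] f
    using nz assms(1,2)
    by (simp add: divide_simps) (simp add: algebra_simps power2_eq_square power3_eq_cube)
qed

section \<open>Nonvanishing denominators\<close>

definition generic :: "complex \<Rightarrow> complex \<Rightarrow> nat \<Rightarrow> bool" where
  "generic q c n \<longleftrightarrow> q \<noteq> 0 \<and> (\<forall>i\<in>{1..n}. q^i \<noteq> 1) \<and> (\<forall>i<2*n. c*q^i \<noteq> 1)"

lemma generic_mono: "generic q c n \<Longrightarrow> m \<le> n \<Longrightarrow> generic q c m"
  by (auto simp: generic_def)

text \<open>
  The denominators of a recurrence that leads from \<open>n\<close> and \<open>n + 1\<close> to \<open>n + 2\<close>. The largest exponents occur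
  at \<open>j = n + 1\<close>: \<open>q^(n+2)\<close> in \<open>q * q^j\<close> and \<open>q^(2n+3)\<close> next to \<open>c\<close>, just inside the range that
  \<open>generic q c (n + 2)\<close> covers.
\<close>

lemma genericD:
  assumes "generic q c (Suc (Suc n))" "j \<le> Suc n"
  shows "q \<noteq> 0" "q^Suc n \<noteq> 0" "q^Suc n \<noteq> 1" "q^Suc n * q \<noteq> 1" "c * q^Suc n \<noteq> 1" "q * q^j \<noteq> 1" "c * q^j \<noteq> 1"
     "c*(q^j)^2 \<noteq> 1" "c*q*(q^j)^2 \<noteq> 1" "c * q^Suc n * q^j \<noteq> 1" "c * q^Suc n * q * q^j \<noteq> 1"
proof -
  have q: "q^i \<noteq> 1" if "0 < i" "i \<le> n+2" for i using assms that by (auto simp: generic_def)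
  have c: "c*q^i \<noteq> 1" if "i < 2*n+4" for i using assms that by (auto simp: generic_def)
  show q0: "q \<noteq> 0" using assms by (simp add: generic_def)
  then show "q^Suc n \<noteq> 0" by simp
  show "q^Suc n \<noteq> 1" "q^Suc n * q \<noteq> 1" "q * q^j \<noteq> 1"
    using q[of "Suc n"] q[of "Suc (Suc n)"] q[of "Suc j"] assms(2) by (simp_all add: mult_ac)
  show "c * q^Suc n \<noteq> 1" "c * q^j \<noteq> 1" "c*(q^j)^2 \<noteq> 1" "c*q*(q^j)^2 \<noteq> 1" "c * q^Suc n * q^j \<noteq> 1" 
    "c * q^Suc n * q * q^j \<noteq> 1"
    using c[of "Suc n"] c[of j] c[of "2*j"] c[of "Suc (2*j)"] c[of "Suc n + j"] c[of "Suc (Suc n + j)"] assms(2)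
    by (simp_all add: power_add power_mult power_even_eq mult_ac)
qed

section \<open>Multiplication in triangular bases\<close>

text \<open>
  The effect on coefficients of an operator that maps the basis element \<open>\<phi>\<^sub>k\<close> to \<open>l\<^sub>k \<phi>\<^sub>k + u\<^sub>k \<phi>\<^sub>k\<^sub>+\<^sub>1\<close>.
\<close>

definition mult_coeffs :: "(nat \<Rightarrow> complex) \<Rightarrow> (nat \<Rightarrow> complex) \<Rightarrow> (nat \<Rightarrow> complex) \<Rightarrow> nat \<Rightarrow> complex" where
  "mult_coeffs l u f k = l k * f k + (case k of 0 \<Rightarrow> 0 | Suc j \<Rightarrow> u j * f j)"

text \<open>
  Treating a sum as a linear functional of its coefficient sequence lets a coefficient identity
  be summed in one step.
\<close>

definition wsum :: "(nat \<Rightarrow> complex) \<Rightarrow> nat \<Rightarrow> (nat \<Rightarrow> complex) \<Rightarrow> complex" where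
  "wsum \<phi> M f = (\<Sum>k\<le>M. f k * \<phi> k)"

lemma wsum_linear:
  "wsum \<phi> M (\<lambda>k. f k + g k) = wsum \<phi> M f + wsum \<phi> M g"
  "wsum \<phi> M (\<lambda>k. f k - g k) = wsum \<phi> M f - wsum \<phi> M g"
  "wsum \<phi> M (\<lambda>k. a * f k) = a * wsum \<phi> M f"
  by (simp_all add: wsum_def sum.distrib sum_subtractf sum_distrib_left algebra_simps)

lemma wsum_cong: "(\<And>k. k \<le> M \<Longrightarrow> f k = g k) \<Longrightarrow> wsum \<phi> M f = wsum \<phi> M g"
  by (simp add: wsum_def)

text \<open>
  Expansions of different lengths occur in the same recurrence; padding with zero coefficients
  brings them to one common upper limit.
\<close>

lemma wsum_pad:
  assumes "\<And>k. n < k \<Longrightarrow> f k = 0" "n \<le> m"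
  shows "wsum \<phi> n f = wsum \<phi> m f"
  unfolding wsum_def by (rule sum.mono_neutral_left) (use assms in auto)

text \<open>
  The only term that can leave the range of summation is the one with \<open>\<phi> (Suc M)\<close>; it has the factor
  \<open>f M\<close>.
\<close>

lemma mult_wsum_eq:
  assumes step: "\<And>k. z * \<phi> k = l k * \<phi> k + u k * \<phi> (Suc k)" and "f M = 0"
  shows "z * wsum \<phi> M f = wsum \<phi> M (mult_coeffs l u f)"
proof -
  have "z * wsum \<phi> m f = wsum \<phi> m (mult_coeffs l u f) + u m * f m * \<phi> (Suc m)" for m
  proof (induction m)
    case 0
    have "z * (f 0 * \<phi> 0) = f 0 * (z * \<phi> 0)" by simp
    also have "\<dots> = f 0 * (l 0 * \<phi> 0 + u 0 * \<phi> (Suc 0))" by (simp only: step)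
    finally show ?case by (simp add: wsum_def mult_coeffs_def algebra_simps)
  next
    case (Suc m)
    have "z * (f (Suc m) * \<phi> (Suc m)) = f (Suc m) * (z * \<phi> (Suc m))" by simp
    also have "\<dots> = f (Suc m) * (l (Suc m) * \<phi> (Suc m) + u (Suc m) * \<phi> (Suc (Suc m)))"
      by (simp only: step)
    finally show ?case using Suc by (simp add: wsum_def mult_coeffs_def algebra_simps)
  qed
  from this[of M] show ?thesis using assms(2) by simp
qed

lemma qpoch_terminates: "q \<noteq> 0 \<Longrightarrow> n < k \<Longrightarrow> qpoch (1/q^n) q k = 0"
  by (auto simp: qpoch_def intro: bexI[of _ n])

lemma coeff_terminates:
  assumes "q \<noteq> 0" "n < k"
  shows "coeffA q c (q^n) k = 0" "coeffB q c (q^n) k = 0" "coeffU q c (q^n) k = 0" "coeffV q c (q^n) k = 0" "coeffW q c (q^n) k = 0"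
  using assms by (simp_all add: coeffA_def coeffB_def coeffU_def coeffV_def coeffW_def qpoch_terminates)

section \<open>Recurrences for the two factors\<close>

definition factorA :: "complex \<Rightarrow> complex \<Rightarrow> complex \<Rightarrow> nat \<Rightarrow> complex" where
  "factorA q c x n = wsum (\<lambda>k. qpoch x (q^2) k) n (coeffA q c (q^n))"

definition factorB :: "complex \<Rightarrow> complex \<Rightarrow> complex \<Rightarrow> nat \<Rightarrow> complex" where
  "factorB q c x n = wsum (\<lambda>k. qpoch x (q^2) k / x^k) n (coeffB q c (q^n))"

lemma power2_power_commute: "((q::complex)^2)^k = (q^k)^2"
  by (simp add: power_mult[symmetric] mult.commute)

lemma factorA_rec:
  assumes "generic q c (Suc (Suc n))"
  shows "(1 - c*q^Suc n) * factorA q c x (Suc (Suc n)) = (x-c)*q^Suc n * factorA q c x (Suc n) + x*(1-q^Suc n) * factorA q c x n"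
proof -
  let ?M = "Suc (Suc n)" and ?m = "mult_coeffs (\<lambda>k. 1/(q^k)^2) (\<lambda>k. -1/(q^k)^2)"
  let ?S = "wsum (\<lambda>k. qpoch x (q^2) k) ?M"
  have q0: "q \<noteq> 0" using assms by (simp add: generic_def)
  have pad: "factorA q c x m = ?S (coeffA q c (q^m))" if "m \<le> ?M" for m
    unfolding factorA_def by (rule wsum_pad) (use that q0 in \<open>auto simp: coeff_terminates\<close>)
  have x: "x * ?S (coeffA q c (q^m)) = ?S (?m (coeffA q c (q^m)))" if "m \<le> Suc n" for m
    by (rule mult_wsum_eq) (use that q0 in \<open>auto simp: coeff_terminates qpoch_Suc power2_power_commute field_simps\<close>)
  have co: "(1 - c*q^Suc n) * coeffA q c (q^?M) k = q^Suc n * (?m (coeffA q c (q^Suc n)) k - c * coeffA q c (q^Suc n) k)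
     + (1-q^Suc n) * ?m (coeffA q c (q^n)) k" if k: "k \<le> ?M" for k
  proof (cases k)
    case 0
    then show ?thesis by (simp add: mult_coeffs_def coeffA_def algebra_simps)
  next
    case (Suc j)
    have "q^?M = q^Suc n*q" "q^n = q^Suc n/q" using q0 by simp_all
    then show ?thesis using coeffA_rec[of q "q^Suc n" j c] genericD[OF assms, of j] k
      unfolding Suc mult_coeffs_def by (simp add: algebra_simps del: power_Suc)
  qed
  have "(1 - c*q^Suc n) * ?S (coeffA q c (q^?M)) = q^Suc n * (?S (?m (coeffA q c (q^Suc n))) - c * ?S (coeffA q c (q^Suc n))) + (1-q^Suc n) * ?S (?m (coeffA q c (q^n)))"
    unfolding wsum_linear[symmetric] by (rule wsum_cong) (rule co)
  also have "\<dots> = q^Suc n * (x * ?S (coeffA q c (q^Suc n)) - c * ?S (coeffA q c (q^Suc n))) + (1-q^Suc n) * (x * ?S (coeffA q c (q^n)))"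
    using x[of n] x[of "Suc n"] by simp
  finally show ?thesis by (simp only: pad) (simp add: algebra_simps)
qed

lemma factorB_rec:
  assumes "generic q c (Suc (Suc n))" "x \<noteq> 0"
  shows "(1 - c*q^Suc n) * factorB q c x (Suc (Suc n)) = (1-c/x) * factorB q c x (Suc n) + c/x*(1-q^Suc n) * factorB q c x n"
proof -
  let ?M = "Suc (Suc n)" and ?m = "mult_coeffs (\<lambda>k. (q^k)^2) (\<lambda>k. 1)"
  let ?S = "wsum (\<lambda>k. qpoch x (q^2) k / x^k) ?M"
  have q0: "q \<noteq> 0" using assms by (simp add: generic_def)
  have pad: "factorB q c x m = ?S (coeffB q c (q^m))" if "m \<le> ?M" for m
    unfolding factorB_def by (rule wsum_pad) (use that q0 in \<open>auto simp: coeff_terminates\<close>)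
  have x: "1/x * ?S (coeffB q c (q^m)) = ?S (?m (coeffB q c (q^m)))" if "m \<le> Suc n" for m
    by (rule mult_wsum_eq) (use that q0 assms(2) in \<open>auto simp: coeff_terminates qpoch_Suc power2_power_commute field_simps\<close>)
  have co: "(1 - c*q^Suc n) * coeffB q c (q^?M) k = coeffB q c (q^Suc n) k - c * ?m (coeffB q c (q^Suc n)) k
     + c*(1-q^Suc n) * ?m (coeffB q c (q^n)) k" if k: "k \<le> ?M" for k
  proof (cases k)
    case 0
    then show ?thesis by (simp add: mult_coeffs_def coeffB_def algebra_simps)
  next
    case (Suc j)
    have "q^?M = q^Suc n*q" "q^n = q^Suc n/q" using q0 by simp_all
    then show ?thesis using coeffB_rec[of q "q^Suc n" j c] genericD[OF assms(1), of j] k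
      unfolding Suc mult_coeffs_def by (simp add: algebra_simps del: power_Suc)
  qed
  have "(1 - c*q^Suc n) * ?S (coeffB q c (q^?M)) = ?S (coeffB q c (q^Suc n)) - c * ?S (?m (coeffB q c (q^Suc n))) + c*(1-q^Suc n) * ?S (?m (coeffB q c (q^n)))"
    unfolding wsum_linear[symmetric] by (rule wsum_cong) (rule co)
  also have "\<dots> = ?S (coeffB q c (q^Suc n)) - c * (1/x * ?S (coeffB q c (q^Suc n))) + c*(1-q^Suc n) * (1/x * ?S (coeffB q c (q^n)))"
    using x[of n] x[of "Suc n"] by simp
  finally show ?thesis by (simp only: pad) (use assms(2) in \<open>simp add: field_simps\<close>)
qed

section \<open>Recurrences for the expansions of the products\<close>

definition phi :: "complex \<Rightarrow> complex \<Rightarrow> complex \<Rightarrow> nat \<Rightarrow> complex" where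
  "phi q c x k = qpoch x (q^2) k * qpoch (c^2/x) (q^2) k"

lemma mult_phi:
  assumes "q \<noteq> 0" "x \<noteq> 0"
  shows "(x-c)*(1-c/x) * phi q c x k = (1-c*(q^k)^2)^2/(q^k)^2 * phi q c x k + (-1/(q^k)^2) * phi q c x (Suc k)"
proof -
  \<comment> \<open>\<open>P\<close> is the ratio of consecutive basis elements, which turns out to be linear in \<open>Z = (x - c) (1 - c/x)\<close>.\<close>
  define P where "P = (1-x*(q^k)^2)*(1-c^2/x*(q^k)^2)"
  have "(x-c)*(1-c/x) = (1-c*(q^k)^2)^2/(q^k)^2 - 1/(q^k)^2 * P"
    unfolding P_def using assms by (simp add: field_simps) (simp add: algebra_simps power2_eq_square power4_eq_xxxx)
  moreover have "phi q c x (Suc k) = phi q c x k * P"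
    by (simp add: phi_def qpoch_Suc power2_power_commute P_def mult_ac)
  ultimately show ?thesis by (simp only:) (simp add: left_diff_distrib)
qed

definition phi_sum ::
  "complex \<Rightarrow> complex \<Rightarrow> complex \<Rightarrow> (complex \<Rightarrow> nat \<Rightarrow> complex) \<Rightarrow> nat \<Rightarrow> complex" where
  "phi_sum q c x f n = wsum (phi q c x) n (f (q^n))"

text \<open>
  The coefficient recurrences, summed over \<open>k\<close>. For \<open>k > 0\<close> they are \<open>coeffU_rec\<close>, \<open>coeffV_rec\<close> and
  \<open>coeffW_rec\<close>; at \<open>k = 0\<close> nothing is carried over from a lower basis element, and they reduce to
  identities in \<open>c\<close> and \<open>Q\<close> because the coefficients there are \<open>1\<close>, \<open>1 - c\<close> and \<open>1 - c\<close>.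
\<close>

lemma phi_sum_rec:
  assumes "generic q c (Suc (Suc n))" "x \<noteq> 0"
  shows "(1 - c*q^Suc n)^2 * phi_sum q c x (coeffU q c) (Suc (Suc n)) = 
      (x-c)*(1-c/x)*q^Suc n * phi_sum q c x (coeffU q c) (Suc n) + c*(1-q^Suc n)*q^Suc n * phi_sum q c x (coeffW q c) (Suc n)
      + (1-q^Suc n) * phi_sum q c x (coeffV q c) (Suc n) + c*(1-q^Suc n)^2 * phi_sum q c x (coeffU q c) n"
   "(1 - c*q^Suc n) * phi_sum q c x (coeffV q c) (Suc (Suc n)) =
      (x-c)*(1-c/x) * phi_sum q c x (coeffU q c) (Suc n) + c*(1-q^Suc n) * phi_sum q c x (coeffW q c) (Suc n)"
   "(1 - c*q^Suc n) * phi_sum q c x (coeffW q c) (Suc (Suc n)) =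
      (x-c)*(1-c/x)*q^Suc n * phi_sum q c x (coeffU q c) (Suc n) + (1-q^Suc n) * phi_sum q c x (coeffV q c) (Suc n)"
proof -
  let ?M = "Suc (Suc n)" and ?m = "mult_coeffs (\<lambda>k. (1-c*(q^k)^2)^2/(q^k)^2) (\<lambda>k. -1/(q^k)^2)"
  let ?S = "wsum (phi q c x) ?M" and ?Q = "q^Suc n"
  have q0: "q \<noteq> 0" using assms by (simp add: generic_def)
  have pad: "phi_sum q c x (coeffU q c) m = ?S (coeffU q c (q^m))"
     "phi_sum q c x (coeffV q c) m = ?S (coeffV q c (q^m))"
     "phi_sum q c x (coeffW q c) m = ?S (coeffW q c (q^m))" if "m \<le> ?M" for m
    unfolding phi_sum_def by (rule wsum_pad; use that q0 in \<open>auto simp: coeff_terminates\<close>)+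
  have Z: "(x-c)*(1-c/x) * ?S (coeffU q c ?Q) = ?S (?m (coeffU q c ?Q))"
    by (rule mult_wsum_eq, rule mult_phi) (use q0 assms(2) in \<open>auto simp: coeff_terminates simp del: power_Suc\<close>)
  have lev: "q^?M = ?Q*q" "q^n = ?Q/q" using q0 by simp_all
  have co: "(1 - c*?Q)^2 * coeffU q c (q^?M) k = ?Q * ?m (coeffU q c ?Q) k + c*(1-?Q)*?Q * coeffW q c ?Q k
      + (1-?Q) * coeffV q c ?Q k + c*(1-?Q)^2 * coeffU q c (q^n) k" (is ?u)
    "(1 - c*?Q) * coeffV q c (q^?M) k = ?m (coeffU q c ?Q) k + c*(1-?Q) * coeffW q c ?Q k" (is ?v)
    "(1 - c*?Q) * coeffW q c (q^?M) k = ?Q * ?m (coeffU q c ?Q) k + (1-?Q) * coeffV q c ?Q k" (is ?w)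
    if k: "k \<le> ?M" for k
  proof -
    have "?u \<and> ?v \<and> ?w"
    proof (cases k)
      case 0
      then show ?thesis by (simp add: mult_coeffs_def coeffU_def coeffV_def coeffW_def algebra_simps power2_eq_square)
    next
      case (Suc j)
      note g = genericD[OF assms(1), of j]
      have "j \<le> Suc n" using k Suc by simp
      note g = g[OF this]
      show ?thesis 
        using coeffU_rec[OF g] coeffV_rec[OF g] coeffW_rec[OF g]
        unfolding Suc mult_coeffs_def lev by (simp del: power_Suc)
    qed
    then show ?u ?v ?w by auto
  qed
  have "(1 - c*?Q)^2 * ?S (coeffU q c (q^?M)) = ?Q * ?S (?m (coeffU q c ?Q)) + c*(1-?Q)*?Q * ?S (coeffW q c ?Q)
      + (1-?Q) * ?S (coeffV q c ?Q) + c*(1-?Q)^2 * ?S (coeffU q c (q^n))"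
    unfolding wsum_linear[symmetric] by (rule wsum_cong) (rule co)
  also have "\<dots> = ?Q * ((x-c)*(1-c/x) * ?S (coeffU q c ?Q)) + c*(1-?Q)*?Q * ?S (coeffW q c ?Q)
      + (1-?Q) * ?S (coeffV q c ?Q) + c*(1-?Q)^2 * ?S (coeffU q c (q^n))"
    by (simp only: Z)
  finally show "(1 - c*q^Suc n)^2 * phi_sum q c x (coeffU q c) (Suc (Suc n)) = 
      (x-c)*(1-c/x)*q^Suc n * phi_sum q c x (coeffU q c) (Suc n) + c*(1-q^Suc n)*q^Suc n * phi_sum q c x (coeffW q c) (Suc n)
      + (1-q^Suc n) * phi_sum q c x (coeffV q c) (Suc n) + c*(1-q^Suc n)^2 * phi_sum q c x (coeffU q c) n"
    by (simp add: pad mult_ac del: power_Suc)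
  have "(1 - c*?Q) * ?S (coeffV q c (q^?M)) = ?S (?m (coeffU q c ?Q)) + c*(1-?Q) * ?S (coeffW q c ?Q)"
    unfolding wsum_linear[symmetric] by (rule wsum_cong) (rule co)
  also have "\<dots> = ((x-c)*(1-c/x) * ?S (coeffU q c ?Q)) + c*(1-?Q) * ?S (coeffW q c ?Q)"
    by (simp only: Z)
  finally show "(1 - c*q^Suc n) * phi_sum q c x (coeffV q c) (Suc (Suc n)) =
      (x-c)*(1-c/x) * phi_sum q c x (coeffU q c) (Suc n) + c*(1-q^Suc n) * phi_sum q c x (coeffW q c) (Suc n)"
    by (simp add: pad mult_ac del: power_Suc)
  have "(1 - c*?Q) * ?S (coeffW q c (q^?M)) = ?Q * ?S (?m (coeffU q c ?Q)) + (1-?Q) * ?S (coeffV q c ?Q)"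
    unfolding wsum_linear[symmetric] by (rule wsum_cong) (rule co)
  also have "\<dots> = ?Q * ((x-c)*(1-c/x) * ?S (coeffU q c ?Q)) + (1-?Q) * ?S (coeffV q c ?Q)"
    by (simp only: Z)
  finally show "(1 - c*q^Suc n) * phi_sum q c x (coeffW q c) (Suc (Suc n)) =
      (x-c)*(1-c/x)*q^Suc n * phi_sum q c x (coeffU q c) (Suc n) + (1-q^Suc n) * phi_sum q c x (coeffV q c) (Suc n)"
    by (simp add: pad mult_ac del: power_Suc)
qed

section \<open>The product formula\<close>

text \<open>
  Both sides of all four equations obey the same recurrences. The induction starts at \<open>n = 0\<close> with
  mixed products of index \<open>1\<close>, because \<open>v\<^sub>0\<close> and \<open>w\<^sub>0\<close> would refer to \<open>A\<^sub>-\<^sub>1\<close> and \<open>B\<^sub>-\<^sub>1\<close>, and their coefficients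
  have the denominator \<open>1 - q^0\<close>.
\<close>

lemma products_eq_phi_sums:
  assumes "generic q c (Suc n)" "x \<noteq> 0"
  shows "factorA q c x n * factorB q c x n = phi_sum q c x (coeffU q c) n \<and>
    factorA q c x (Suc n) * factorB q c x (Suc n) = phi_sum q c x (coeffU q c) (Suc n) \<and>
    (x-c) * factorA q c x n * factorB q c x (Suc n) = phi_sum q c x (coeffV q c) (Suc n) \<and>
    (1-c/x) * factorA q c x (Suc n) * factorB q c x n = phi_sum q c x (coeffW q c) (Suc n)"
  using assms(1)
proof (induction n)
  case 0
  have nz: "q \<noteq> 0" "1 - q \<noteq> 0" "1 - c \<noteq> 0" "1 - c*q \<noteq> 0" "q - c*q \<noteq> 0" "q - c*q*q \<noteq> 0"
  proof -
    have c: "c*q^i \<noteq> 1" if "i < 2" for i using 0 that by (auto simp: generic_def)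
    have "q \<noteq> 0" "q \<noteq> 1" using 0 by (auto simp: generic_def)
    moreover have "c \<noteq> 1" "c*q \<noteq> 1" using c[of 0] c[of 1] by simp_all
    ultimately show "q \<noteq> 0" "1 - q \<noteq> 0" "1 - c \<noteq> 0" "1 - c*q \<noteq> 0" "q - c*q \<noteq> 0" "q - c*q*q \<noteq> 0" by auto
  qed
  have one: "qpoch a p (Suc 0) = 1 - a" "qpoch a p 2 = (1-a)*(1-a*p)" for a p
    using qpoch_Suc[of a p 0] qpoch_Suc[of a p 1] by (simp_all add: numeral_2_eq_2)
  show ?case
    unfolding factorA_def factorB_def phi_sum_def wsum_def phi_def coeffA_def coeffB_def coeffU_def coeffV_def coeffW_def
    using nz assms(2)
    by (simp add: one, simp add: divide_simps, simp add: algebra_simps power2_eq_square)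
next
  case (Suc n)
  have "generic q c (Suc n)" using generic_mono[OF Suc.prems] by simp
  note IH = Suc.IH[OF this]
  define \<alpha> where "\<alpha> = 1 - c*q^Suc n"
  define p where "p = q^Suc n"
  have \<alpha>: "\<alpha> \<noteq> 0" using genericD(5)[OF Suc.prems, of 0] by (simp add: \<alpha>_def)
  note a = factorA_rec[OF Suc.prems, of x, folded \<alpha>_def p_def]
  note b = factorB_rec[OF Suc.prems assms(2), folded \<alpha>_def p_def]
  note r = phi_sum_rec[OF Suc.prems assms(2), folded \<alpha>_def p_def]
  define A0 A1 A2 B0 B1 B2 where d: "A0 = factorA q c x n" "A1 = factorA q c x (Suc n)" "A2 = factorA q c x (Suc (Suc n))"
     "B0 = factorB q c x n" "B1 = factorB q c x (Suc n)" "B2 = factorB q c x (Suc (Suc n))" 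
  note a = a[folded d] and b = b[folded d] and r = r[folded d]
  from IH have IH': "phi_sum q c x (coeffU q c) n = A0*B0" "phi_sum q c x (coeffU q c) (Suc n) = A1*B1"
     "phi_sum q c x (coeffV q c) (Suc n) = (x-c)*A0*B1" "phi_sum q c x (coeffW q c) (Suc n) = (1-c/x)*A1*B0" by (simp_all add: d)
  note r = r[unfolded IH']
  \<comment> \<open>Expanding \<open>A2\<close> and \<open>B2\<close> by their recurrences gives exactly the right-hand sides of the system.\<close>
  have "\<alpha>^2 * (A2*B2) = (\<alpha>*A2)*(\<alpha>*B2)" by (simp add: power2_eq_square)
  also have "\<dots> = \<alpha>^2 * phi_sum q c x (coeffU q c) (Suc (Suc n))"
    unfolding a b r using assms(2) by (simp add: field_simps power2_eq_square)
  finally have u: "A2*B2 = phi_sum q c x (coeffU q c) (Suc (Suc n))" using \<alpha> by simp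
  have "\<alpha> * ((x-c)*A1*B2) = (x-c)*A1*(\<alpha>*B2)" by simp
  also have "\<dots> = \<alpha> * phi_sum q c x (coeffV q c) (Suc (Suc n))"
    unfolding a b r using assms(2) by (simp add: field_simps)
  finally have v: "(x-c)*A1*B2 = phi_sum q c x (coeffV q c) (Suc (Suc n))" using \<alpha> by simp
  have "\<alpha> * ((1-c/x)*A2*B1) = (1-c/x)*(\<alpha>*A2)*B1" by simp
  also have "\<dots> = \<alpha> * phi_sum q c x (coeffW q c) (Suc (Suc n))"
    unfolding a b r using assms(2) by (simp add: field_simps)
  finally have w: "(1-c/x)*A2*B1 = phi_sum q c x (coeffW q c) (Suc (Suc n))" using \<alpha> by simp
  show ?case using u v w IH' by (simp add: d)
qed

lemma generic_if_qpoch_nonzero: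
  assumes "q \<noteq> 0" "qpoch q q n \<noteq> 0" "qpoch c q (2*n) \<noteq> 0"
  shows "generic q c n"
proof -
  have "q^i \<noteq> 1" if "i \<in> {1..n}" for i
  proof -
    from that have "\<exists>j. i = Suc j \<and> j < n" by (cases i) auto
    then obtain j where "i = Suc j" "j < n" by blast
    then show ?thesis using assms(2) by (auto simp: qpoch_def)
  qed
  moreover have "c*q^i \<noteq> 1" if "i < 2*n" for i
    using assms(3) that by (auto simp: qpoch_def)
  ultimately show ?thesis using assms(1) by (simp add: generic_def)
qed

theorem theorem1p4:
  fixes n :: nat and q x c :: complex
  assumes "q \<noteq> 0" and "x \<noteq> 0"
    and "\<And>k. k \<le> n \<Longrightarrow> qpoch q q k \<noteq> 0"
    and "\<And>k. k \<le> n \<Longrightarrow> qpoch c q k \<noteq> 0"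
    and "\<And>k. k \<le> n \<Longrightarrow> qpoch c q (2 * k) \<noteq> 0"
  shows
    "(\<Sum>k=0..n. (qpoch (q powi (- int n)) q k * qpoch x (q ^ 2) k * q ^ k)
        / (qpoch q q k * qpoch c q k))
     * (\<Sum>k=0..n. (qpoch (q powi (- int n)) q k * qpoch x (q ^ 2) k * c ^ k
          * q powi (int n * int k - int (k choose 2)))
        / (qpoch q q k * qpoch c q k * x ^ k))
     = (\<Sum>k=0..n. (qpoch (q powi (- int n)) q k * qpoch (c * q ^ n) q k
          * qpoch x (q ^ 2) k * qpoch (c ^ 2 / x) (q ^ 2) k * q ^ k)
        / (qpoch q q k * qpoch c q k * qpoch c q (2 * k)))"
proof -
  have gen: "generic q c n" using generic_if_qpoch_nonzero assms(1) assms(3,5)[of n] by simp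
  have qn: "q powi (- int n) = 1/q^n" by (simp add: power_int_minus divide_inverse)
  have qk: "q powi (int n * int k - int (k choose 2)) = (q^n)^k / q^(k choose 2)" for k
    using assms(1) by (simp add: power_int_diff power_int_mult)
  have A: "(\<Sum>k=0..n. (qpoch (q powi (- int n)) q k * qpoch x (q ^ 2) k * q ^ k)
        / (qpoch q q k * qpoch c q k)) = factorA q c x n"
    unfolding factorA_def wsum_def coeffA_def qn atLeast0AtMost by (rule sum.cong) (simp_all add: mult_ac)
  have B: "(\<Sum>k=0..n. (qpoch (q powi (- int n)) q k * qpoch x (q ^ 2) k * c ^ k
          * q powi (int n * int k - int (k choose 2)))
        / (qpoch q q k * qpoch c q k * x ^ k)) = factorB q c x n"
    unfolding factorB_def wsum_def coeffB_def qn qk atLeast0AtMost by (rule sum.cong) (simp_all add: mult_ac power_mult_distrib)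
  have U: "(\<Sum>k=0..n. (qpoch (q powi (- int n)) q k * qpoch (c * q ^ n) q k
          * qpoch x (q ^ 2) k * qpoch (c ^ 2 / x) (q ^ 2) k * q ^ k)
        / (qpoch q q k * qpoch c q k * qpoch c q (2 * k))) = phi_sum q c x (coeffU q c) n"
    unfolding phi_sum_def phi_def wsum_def coeffU_def qn atLeast0AtMost by (rule sum.cong) (simp_all add: mult_ac)
  have "factorA q c x n * factorB q c x n = phi_sum q c x (coeffU q c) n"
  proof (cases n)
    case 0
    then show ?thesis by (simp add: factorA_def factorB_def phi_sum_def wsum_def phi_def coeffA_def coeffB_def coeffU_def)
  next
    case (Suc m)
    then show ?thesis using products_eq_phi_sums[of q c m x] gen assms(2) by simp
  qed
  then show ?thesis unfolding A B U .
qed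

end
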